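(* Let $S \in C^1(Z)$, let $\mathbf{F}$ be a vector field on $Z$, and let $(\Psi,\Psi^* )$ be a pair of Legendre duals, both strictly convex and continuously differentiable. Let $W$ be a vector field on $Z$ orthogonal to $\mathrm{d}S$, i.e. $\langle W(z), \mathrm{d}S(z)\rangle = 0$ for all $z\in Z$, and let $\mathcal{H}_1(z,\xi) = \langle W(z),\xi\rangle$. Let $\mathcal{H}_2 : T^*Z \to \mathbb{R}$ be related to $\Psi^*$ by $$\Psi^*(z,\xi) = \mathcal{H}_2\bigl(z,\xi+\tfrac12 \mathrm{d}S(z)\bigr) - \mathcal{H}_2\bigl(z,\tfrac12 \mathrm{d}S(z)\bigr), \qquad \mathcal{H}_2(z,\xi) = \Psi^*\bigl(z,\xi-\tfrac12 \mathrm{d}S(z)\bigr) - \Psi^*\bigl(z,-\tfrac12 \mathrm{d}S(z)\bigr).$$ Let $\mathcal{H} := \mathcal{H}_1+\mathcal{H}_2$ and let $\mathcal{L}$ be the Legendre dual of $\mathcal{H}$. Then the following are equivalent: (a) $\mathcal{H}_2$ is reversible with respect to $S$, and $\mathbf{F}$ is the zero-cost flow for $\mathcal{L}$. (b) $\Psi^*$ is symmetric, and $\mathbf{F}$ is pre-GENERIC for $S$ with dissipation potentials $(\Psi,\Psi^* )$ and vector field $W$. If (a) or (b) is satisfied, then $S$ is a Lyapunov function for $\mathbf{F}$.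
   Context: $Z$ is a smooth finite-dimensional manifold with tangent bundle $TZ$ and cotangent bundle $T^*Z$; $\langle\cdot,\cdot\rangle$ is the pairing between $T_zZ$ and $T_z^*Z$ (in either order). A vector field is a continuous section $V(z)\in T_zZ$. $C^1(Z)$ is the set of continuously differentiable real functions, with differential $\mathrm{d}F(z)\in T_z^*Z$. Legendre duals: $\Psi: TZ\to[0,\infty]$ and $\Psi^*:T^*Z\to[0,\infty]$ are Legendre duals if $\Psi^*(z,\xi)=\sup_{v\in T_zZ}\{\langle v,\xi\rangle-\Psi(z,v)\}$ and $\Psi(z,v)=\sup_{\xi\in T^*_zZ}\{\langle v,\xi\rangle-\Psi^*(z,\xi)\}$. Likewise the Legendre dual of $\mathcal{H}:T^*Z\to\mathbb{R}$ is $\mathcal{L}(z,v)=\sup_{\xi}\{\langle v,\xi\rangle-\mathcal{H}(z,\xi)\}$. Hamiltonians and Lagrangians are assumed convex in the second argument, with $\mathcal{H}(z,0)=0$ (equivalently $\mathcal{L}\ge 0$ and for each $z$ there is $v$ with $\mathcal{L}(z,v)=0$). Dissipation potentials: a Legendre pair $(\Psi,\Psi^* )$ such that $\Psi,\Psi^*$ are strictly convex, continuously differentiable and $\Psi(z,0)=\Psi^*(z,0)=0$. $\Psi$ (resp. $\Psi^*$) is symmetric if $\Psi(z,v)=\Psi(z,-v)$ (resp. $\Psi^*(z,\xi)=\Psi^*(z,-\xi)$) everywhere. Reversible: $\mathcal{H}$ is reversible with respect to $S$ if $\mathcal{H}(z,\xi)=\mathcal{H}(z,\mathrm{d}S(z)-\xi)$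 for all $(z,\xi)\in T^*Z$. Zero-cost flow: $\mathbf{F}$ is the zero-cost flow for $\mathcal{L}$ if for all $(z,v)\in TZ$: $\mathcal{L}(z,v)=0$ if and only if $v=\mathbf{F}(z)$. Pre-GENERIC: $\mathbf{F}$ is pre-GENERIC for $S$ with dissipation potentials $(\Psi,\Psi^* )$ and vector field $W$ if $\Psi,\Psi^*$ are symmetric, $\langle W(z),\mathrm{d}S(z)\rangle=0$ for all $z$, and for all $z\in Z$ $$\Psi(z,\mathbf{F}(z)-W(z))+\Psi^*\bigl(z,-\tfrac12\mathrm{d}S(z)\bigr)+\tfrac12\langle \mathbf{F}(z),\mathrm{d}S(z)\rangle=0.$$ Lyapunov function: $S$ is a Lyapunov function for $\mathbf{F}$ if $\langle \mathbf{F}(z),\mathrm{d}S(z)\rangle\le 0$ for all $z$ (so $S$ is non-increasing along solutions of $\dot z=\mathbf{F}(z)$). *)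

theory Defs
  imports "HOL-Analysis.Analysis" "HOL-Library.Function_Algebras"
begin

(* Tangent vectors and covectors are represented below by functions, with the pointwise
   real vector space structure; the additive part is in HOL-Library. *)
instantiation "fun" :: (type, real_vector) real_vector
begin

definition scaleR_fun :: "real \<Rightarrow> ('a \<Rightarrow> 'b) \<Rightarrow> 'a \<Rightarrow> 'b" where
  "scaleR_fun r f = (\<lambda>x. r *\<^sub>R f x)"

instance
  by standard (simp_all add: scaleR_fun_def fun_eq_iff scaleR_add_right scaleR_add_left)

end

lemma scaleR_fun_apply [simp]: "(r *\<^sub>R f) x = r *\<^sub>R f x"
  by (simp add: scaleR_fun_def)


section \<open>Smooth manifolds\<close>

(* k times continuously differentiable on an open subset of a finite-dimensional space:
   all directional derivatives up to order k exist and are continuous. *)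
primrec Ck_on :: "nat \<Rightarrow> 'a::real_normed_vector set \<Rightarrow> ('a \<Rightarrow> 'b::real_normed_vector) \<Rightarrow> bool" where
  "Ck_on 0 S f \<longleftrightarrow> continuous_on S f"
| "Ck_on (Suc k) S f \<longleftrightarrow> (\<forall>x\<in>S. f differentiable at x) \<and>
     (\<forall>u. Ck_on k S (\<lambda>x. frechet_derivative f (at x) u))"

definition smooth_on :: "'a::real_normed_vector set \<Rightarrow> ('a \<Rightarrow> 'b::real_normed_vector) \<Rightarrow> bool" where
  "smooth_on S f \<longleftrightarrow> (\<forall>k. Ck_on k S f)"

(* A chart is its domain together with its coordinate map, whose values outside the
   domain are irrelevant. *)
type_synonym ('z, 'e) chart = "'z set \<times> ('z \<Rightarrow> 'e)"

abbreviation chart_inv :: "('z, 'e) chart \<Rightarrow> 'e \<Rightarrow> 'z" where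
  "chart_inv c \<equiv> inv_into (fst c) (snd c)"

definition is_chart :: "('z::topological_space, 'e::real_normed_vector) chart \<Rightarrow> bool" where
  "is_chart c \<longleftrightarrow> open (fst c) \<and> open (snd c ` fst c) \<and>
     homeomorphism (fst c) (snd c ` fst c) (snd c) (chart_inv c)"

(* The manifold Z is the type 'z, with a smooth atlas A (not necessarily maximal) modelled on a
   finite-dimensional normed space 'e. The class euclidean_space is not used for 'e because
   it excludes dimension 0. *)
definition smooth_manifold ::
    "('z::{t2_space, second_countable_topology}, 'e::real_normed_vector) chart set \<Rightarrow> bool" where
  "smooth_manifold A \<longleftrightarrow>
     (\<exists>B::'e set. finite B \<and> span B = UNIV) \<and>
     (\<forall>c\<in>A. is_chart c) \<and>
     (\<Union>c\<in>A. fst c) = UNIV \<and>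
     (\<forall>c\<in>A. \<forall>c'\<in>A. smooth_on (snd c ` (fst c \<inter> fst c')) (snd c' \<circ> chart_inv c))"

definition charts_at :: "('z, 'e) chart set \<Rightarrow> 'z \<Rightarrow> ('z, 'e) chart set" where
  "charts_at A z = {c \<in> A. z \<in> fst c}"


section \<open>Tangent and cotangent spaces\<close>

definition coord_change ::
    "('z, 'e::real_normed_vector) chart \<Rightarrow> ('z, 'e) chart \<Rightarrow> 'z \<Rightarrow> 'e \<Rightarrow> 'e" where
  "coord_change c c' z = frechet_derivative (snd c' \<circ> chart_inv c) (at (snd c z))"

(* A tangent vector at z is the family (v c) of its coordinates in all charts c around z,
   transforming by the derivatives of the chart transitions. The value is 0 at all other c,
   so that equality of tangent vectors is equality of functions. *)
type_synonym ('z, 'e) tvec = "('z, 'e) chart \<Rightarrow> 'e"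

definition tangent_space ::
    "('z, 'e::real_normed_vector) chart set \<Rightarrow> 'z \<Rightarrow> ('z, 'e) tvec set" where
  "tangent_space A z =
     {v. (\<forall>c\<in>charts_at A z. \<forall>c'\<in>charts_at A z. v c' = coord_change c c' z (v c)) \<and>
         (\<forall>c. c \<notin> charts_at A z \<longrightarrow> v c = 0)}"

(* Covectors are the linear functionals on the tangent space, extended by 0. The pairing of a
   tangent vector v and a covector \<xi> is the application \<xi> v. *)
type_synonym ('z, 'e) covec = "('z, 'e) tvec \<Rightarrow> real"

definition cotangent_space ::
    "('z, 'e::real_normed_vector) chart set \<Rightarrow> 'z \<Rightarrow> ('z, 'e) covec set" where
  "cotangent_space A z =
     {\<xi>. (\<forall>v\<in>tangent_space A z. \<forall>w\<in>tangent_space A z. \<xi> (v + w) = \<xi> v + \<xi> w) \<and>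
         (\<forall>r. \<forall>v\<in>tangent_space A z. \<xi> (r *\<^sub>R v) = r * \<xi> v) \<and>
         (\<forall>v. v \<notin> tangent_space A z \<longrightarrow> \<xi> v = 0)}"

definition C1_function :: "('z, 'e::real_normed_vector) chart set \<Rightarrow> ('z \<Rightarrow> real) \<Rightarrow> bool" where
  "C1_function A S \<longleftrightarrow> (\<forall>c\<in>A. Ck_on 1 (snd c ` fst c) (S \<circ> chart_inv c))"

(* The value does not depend on the chart that is selected: see differential_in_chart. *)
definition differential ::
    "('z, 'e::real_normed_vector) chart set \<Rightarrow> ('z \<Rightarrow> real) \<Rightarrow> 'z \<Rightarrow> ('z, 'e) covec" where
  "differential A S z = (\<lambda>v. if v \<in> tangent_space A z then
     (let c = (SOME c. c \<in> charts_at A z)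
      in frechet_derivative (S \<circ> chart_inv c) (at (snd c z)) (v c)) else 0)"

definition vector_field ::
    "('z::topological_space, 'e::real_normed_vector) chart set \<Rightarrow> ('z \<Rightarrow> ('z, 'e) tvec) \<Rightarrow> bool" where
  "vector_field A V \<longleftrightarrow> (\<forall>z. V z \<in> tangent_space A z) \<and>
     (\<forall>c\<in>A. continuous_on (fst c) (\<lambda>z. V z c))"

definition tvec_of ::
    "('z, 'e::real_normed_vector) chart set \<Rightarrow> 'z \<Rightarrow> ('z, 'e) chart \<Rightarrow> 'e \<Rightarrow> ('z, 'e) tvec" where
  "tvec_of A z c a = (\<lambda>c'. if c' \<in> charts_at A z then coord_change c c' z a else 0)"

(* The covector which, in the chart c, is the linear functional \<alpha> on coordinates. *)
definition covec_of ::
    "('z, 'e::real_normed_vector) chart set \<Rightarrow> 'z \<Rightarrow> ('z, 'e) chart \<Rightarrow> ('e \<Rightarrow>\<^sub>L real) \<Rightarrow> ('z, 'e) covec" where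
  "covec_of A z c \<alpha> = (\<lambda>v. if v \<in> tangent_space A z then blinfun_apply \<alpha> (v c) else 0)"


subsection \<open>Consistency of the coordinate descriptions\<close>

lemma chart_transition_has_derivative:
  assumes M: "smooth_manifold A" and c: "c \<in> charts_at A z" and c': "c' \<in> charts_at A z"
  shows "((snd c' \<circ> chart_inv c) has_derivative coord_change c c' z) (at (snd c z))"
proof -
  have "Ck_on 1 (snd c ` (fst c \<inter> fst c')) (snd c' \<circ> chart_inv c)"
    using M c c' unfolding smooth_manifold_def smooth_on_def charts_at_def by blast
  hence "(snd c' \<circ> chart_inv c) differentiable at (snd c z)"
    using c c' by (auto simp: charts_at_def)
  thus ?thesis
    unfolding coord_change_def by (simp add: frechet_derivative_works)
qed

lemma chart_inv_chart:
  assumes "smooth_manifold A" "c \<in> A" "x \<in> fst c"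
  shows "chart_inv c (snd c x) = x"
  using assms unfolding smooth_manifold_def is_chart_def homeomorphism_def by blast

lemma open_chart_image:
  assumes M: "smooth_manifold A" and c: "c \<in> A" and U: "open U"
  shows "open (snd c ` (fst c \<inter> U))"
proof -
  have *: "open (fst c)" "open (snd c ` fst c)"
    "homeomorphism (fst c) (snd c ` fst c) (snd c) (chart_inv c)"
    using M c unfolding smooth_manifold_def is_chart_def by auto
  have "openin (top_of_set (snd c ` fst c)) (snd c ` (fst c \<inter> U))"
    by (rule homeomorphism_imp_open_map[OF *(3)]) (use U in auto)
  thus ?thesis using *(2) openin_open_trans by blast
qed

lemma has_derivative_change_chart:
  assumes M: "smooth_manifold A" and c: "c \<in> charts_at A z" and c': "c' \<in> charts_at A z"
    and f: "((f \<circ> chart_inv c') has_derivative D) (at (snd c' z))"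
  shows "((f \<circ> chart_inv c) has_derivative (D \<circ> coord_change c c' z)) (at (snd c z))"
proof -
  have inA: "c \<in> A" "c' \<in> A" "z \<in> fst c" "z \<in> fst c'"
    using c c' by (auto simp: charts_at_def)
  have z: "chart_inv c (snd c z) = z"
    using chart_inv_chart[OF M] inA by blast
  have 1: "((f \<circ> chart_inv c' \<circ> (snd c' \<circ> chart_inv c)) has_derivative (D \<circ> coord_change c c' z))
      (at (snd c z))"
    by (rule diff_chain_at[OF chart_transition_has_derivative[OF M c c']]) (use f z in simp)
  show ?thesis
  proof (rule has_derivative_transform_within_open[OF 1])
    have "open (fst c')"
      using M inA unfolding smooth_manifold_def is_chart_def by blast
    thus "open (snd c ` (fst c \<inter> fst c'))"
      using open_chart_image[OF M inA(1)] by blast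
    show "snd c z \<in> snd c ` (fst c \<inter> fst c')"
      using inA by blast
    show "(f \<circ> chart_inv c' \<circ> (snd c' \<circ> chart_inv c)) x = (f \<circ> chart_inv c) x"
      if "x \<in> snd c ` (fst c \<inter> fst c')" for x
      using that chart_inv_chart[OF M] inA by auto
  qed
qed

lemma coord_change_trans:
  assumes M: "smooth_manifold A"
    and "c \<in> charts_at A z" "c' \<in> charts_at A z" "c'' \<in> charts_at A z"
  shows "coord_change c' c'' z (coord_change c c' z a) = coord_change c c'' z a"
proof -
  have "coord_change c' c'' z \<circ> coord_change c c' z = coord_change c c'' z"
    using assms by (intro has_derivative_unique[OF has_derivative_change_chart
          chart_transition_has_derivative]) (auto intro: chart_transition_has_derivative)
  thus ?thesis by (metis comp_apply)
qed

lemma coord_change_refl: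
  assumes M: "smooth_manifold A" and c: "c \<in> charts_at A z"
  shows "coord_change c c z a = a"
proof -
  have inA: "c \<in> A" "z \<in> fst c"
    using c by (auto simp: charts_at_def)
  have "((snd c \<circ> chart_inv c) has_derivative (\<lambda>a. a)) (at (snd c z))"
  proof (rule has_derivative_transform_within_open[OF has_derivative_ident])
    show "open (snd c ` (fst c \<inter> UNIV))"
      using open_chart_image[OF M inA(1)] by blast
    show "snd c z \<in> snd c ` (fst c \<inter> UNIV)"
      using inA by blast
    show "x = (snd c \<circ> chart_inv c) x" if "x \<in> snd c ` (fst c \<inter> UNIV)" for x
      using that by (auto simp: f_inv_into_f)
  qed
  hence "coord_change c c z = (\<lambda>a. a)"
    using chart_transition_has_derivative[OF M c c] has_derivative_unique by blast
  thus ?thesis by simp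
qed

lemma tangent_space_coordinates:
  assumes M: "smooth_manifold A" and c: "c \<in> charts_at A z"
  shows "bij_betw (\<lambda>v. v c) (tangent_space A z) UNIV"
    and "tvec_of A z c a \<in> tangent_space A z"
    and "tvec_of A z c a c = a"
proof -
  show 1: "tvec_of A z c a \<in> tangent_space A z" for a
    using coord_change_trans[OF M c] by (simp add: tvec_of_def tangent_space_def)
  show 2: "tvec_of A z c a c = a" for a
    using coord_change_refl[OF M c] c by (simp add: tvec_of_def)
  have "v = tvec_of A z c (v c)" if "v \<in> tangent_space A z" for v
  proof
    show "v c' = tvec_of A z c (v c) c'" for c'
    proof (cases "c' \<in> charts_at A z")
      case True
      hence "v c' = coord_change c c' z (v c)"
        using that c unfolding tangent_space_def by blast
      with True show ?thesis unfolding tvec_of_def by (simp only: if_True)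
    next
      case False
      hence "v c' = 0"
        using that unfolding tangent_space_def by blast
      with False show ?thesis unfolding tvec_of_def by (simp only: if_False)
    qed
  qed
  with 1 2 show "bij_betw (\<lambda>v. v c) (tangent_space A z) UNIV"
    by (intro bij_betwI[where g = "tvec_of A z c"]) auto
qed

lemma subspace_tangent_space:
  assumes M: "smooth_manifold A"
  shows "subspace (tangent_space A z)"
proof -
  have "linear (coord_change c c' z)" if "c \<in> charts_at A z" "c' \<in> charts_at A z" for c c'
    using chart_transition_has_derivative[OF M that] has_derivative_linear by blast
  hence lin: "coord_change c c' z 0 = 0"
    "coord_change c c' z (x + y) = coord_change c c' z x + coord_change c c' z y"
    "coord_change c c' z (r *\<^sub>R x) = r *\<^sub>R coord_change c c' z x"
    if "c \<in> charts_at A z" "c' \<in> charts_at A z" for c c' x y and r :: real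
    using that linear_0 linear_add linear_scale by blast+
  have mem: "v \<in> tangent_space A z" if
    "\<And>c c'. c \<in> charts_at A z \<Longrightarrow> c' \<in> charts_at A z \<Longrightarrow> coord_change c c' z (v c) = v c'"
    "\<And>c. c \<notin> charts_at A z \<Longrightarrow> v c = 0" for v
    unfolding tangent_space_def using that by force
  have memD: "coord_change c c' z (v c) = v c'" if
    "v \<in> tangent_space A z" "c \<in> charts_at A z" "c' \<in> charts_at A z" for v c c'
    using that unfolding tangent_space_def by fastforce
  have mem0: "v c = 0" if "v \<in> tangent_space A z" "c \<notin> charts_at A z" for v c
    using that unfolding tangent_space_def by fastforce
  show ?thesis
    by (rule subspaceI; rule mem) (simp_all add: lin memD mem0)
qed

lemma differential_in_chart:
  assumes M: "smooth_manifold A" and S: "C1_function A S"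
    and c: "c \<in> charts_at A z" and v: "v \<in> tangent_space A z"
  shows "differential A S z v = frechet_derivative (S \<circ> chart_inv c) (at (snd c z)) (v c)"
proof -
  define c' where "c' = (SOME c. c \<in> charts_at A z)"
  have c': "c' \<in> charts_at A z"
    unfolding c'_def using c by (rule someI)
  have D: "((S \<circ> chart_inv d) has_derivative
      frechet_derivative (S \<circ> chart_inv d) (at (snd d z))) (at (snd d z))"
    if "d \<in> charts_at A z" for d
    using S that by (auto simp: C1_function_def charts_at_def frechet_derivative_works)
  have "frechet_derivative (S \<circ> chart_inv c') (at (snd c' z)) \<circ> coord_change c c' z =
      frechet_derivative (S \<circ> chart_inv c) (at (snd c z))"
    using has_derivative_change_chart[OF M c c' D[OF c']] D[OF c] has_derivative_unique by blast
  moreover have "v c' = coord_change c c' z (v c)"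
    using v c c' unfolding tangent_space_def by blast
  ultimately have "frechet_derivative (S \<circ> chart_inv c') (at (snd c' z)) (v c') =
      frechet_derivative (S \<circ> chart_inv c) (at (snd c z)) (v c)"
    by (metis comp_apply)
  thus ?thesis
    using v unfolding differential_def Let_def c'_def by (simp only: if_True)
qed

lemma differential_in_cotangent_space:
  assumes M: "smooth_manifold A" and S: "C1_function A S"
  shows "differential A S z \<in> cotangent_space A z"
proof -
  obtain c where c: "c \<in> charts_at A z"
    using M unfolding smooth_manifold_def charts_at_def by blast
  let ?D = "frechet_derivative (S \<circ> chart_inv c) (at (snd c z))"
  have "linear ?D"
    using S c by (intro linear_frechet_derivative) (auto simp: C1_function_def charts_at_def)
  moreover have "differential A S z v = 0" if "v \<notin> tangent_space A z" for v
    using that by (simp add: differential_def)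
  ultimately show ?thesis
    using differential_in_chart[OF M S c] subspace_tangent_space[OF M, of z]
    by (simp add: cotangent_space_def subspace_add subspace_scale linear_add linear_scale)
qed


section \<open>Legendre duality and dissipation potentials\<close>

definition legendre_duals ::
    "('z, 'e::real_normed_vector) chart set \<Rightarrow> ('z \<Rightarrow> ('z, 'e) tvec \<Rightarrow> ereal) \<Rightarrow>
     ('z \<Rightarrow> ('z, 'e) covec \<Rightarrow> ereal) \<Rightarrow> bool" where
  "legendre_duals A \<Psi> \<Psi>s \<longleftrightarrow>
     (\<forall>z. \<forall>v\<in>tangent_space A z. 0 \<le> \<Psi> z v) \<and>
     (\<forall>z. \<forall>\<xi>\<in>cotangent_space A z. 0 \<le> \<Psi>s z \<xi>) \<and>
     (\<forall>z. \<forall>\<xi>\<in>cotangent_space A z. \<Psi>s z \<xi> = (SUP v\<in>tangent_space A z. ereal (\<xi> v) - \<Psi> z v)) \<and>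
     (\<forall>z. \<forall>v\<in>tangent_space A z. \<Psi> z v = (SUP \<xi>\<in>cotangent_space A z. ereal (\<xi> v) - \<Psi>s z \<xi>))"

definition legendre_dual ::
    "('z, 'e::real_normed_vector) chart set \<Rightarrow> ('z \<Rightarrow> ('z, 'e) covec \<Rightarrow> real) \<Rightarrow>
     'z \<Rightarrow> ('z, 'e) tvec \<Rightarrow> ereal" where
  "legendre_dual A H z v = (SUP \<xi>\<in>cotangent_space A z. ereal (\<xi> v - H z \<xi>))"

(* Strict convexity of a [0,\<infinity>]-valued function on its effective domain; where f is infinite the
   convexity inequality is trivial. *)
definition strictly_convex_on :: "'a::real_vector set \<Rightarrow> ('a \<Rightarrow> ereal) \<Rightarrow> bool" where
  "strictly_convex_on V f \<longleftrightarrow>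
     (\<forall>v\<in>V. \<forall>w\<in>V. \<forall>t::real. v \<noteq> w \<and> f v < \<infinity> \<and> f w < \<infinity> \<and> 0 < t \<and> t < 1 \<longrightarrow>
        f ((1 - t) *\<^sub>R v + t *\<^sub>R w) < ereal (1 - t) * f v + ereal t * f w)"

(* Strict convexity and continuous differentiability of functions on TZ and T*Z concern the
   second argument. In particular no regularity in z is imposed, so that every function
   that is continuously differentiable on the total space TZ or T*Z is included. *)
definition strictly_convex_T ::
    "('z, 'e::real_normed_vector) chart set \<Rightarrow> ('z \<Rightarrow> ('z, 'e) tvec \<Rightarrow> ereal) \<Rightarrow> bool" where
  "strictly_convex_T A \<Psi> \<longleftrightarrow> (\<forall>z. strictly_convex_on (tangent_space A z) (\<Psi> z))"

definition strictly_convex_Ts ::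
    "('z, 'e::real_normed_vector) chart set \<Rightarrow> ('z \<Rightarrow> ('z, 'e) covec \<Rightarrow> ereal) \<Rightarrow> bool" where
  "strictly_convex_Ts A \<Psi>s \<longleftrightarrow> (\<forall>z. strictly_convex_on (cotangent_space A z) (\<Psi>s z))"

definition C1_T ::
    "('z, 'e::real_normed_vector) chart set \<Rightarrow> ('z \<Rightarrow> ('z, 'e) tvec \<Rightarrow> ereal) \<Rightarrow> bool" where
  "C1_T A \<Psi> \<longleftrightarrow> (\<forall>z. (\<forall>v\<in>tangent_space A z. \<bar>\<Psi> z v\<bar> \<noteq> \<infinity>) \<and>
     (\<forall>c\<in>charts_at A z. Ck_on 1 UNIV (\<lambda>a. real_of_ereal (\<Psi> z (tvec_of A z c a)))))"

definition C1_Ts ::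
    "('z, 'e::real_normed_vector) chart set \<Rightarrow> ('z \<Rightarrow> ('z, 'e) covec \<Rightarrow> ereal) \<Rightarrow> bool" where
  "C1_Ts A \<Psi>s \<longleftrightarrow> (\<forall>z. (\<forall>\<xi>\<in>cotangent_space A z. \<bar>\<Psi>s z \<xi>\<bar> \<noteq> \<infinity>) \<and>
     (\<forall>c\<in>charts_at A z. Ck_on 1 UNIV (\<lambda>\<alpha>. real_of_ereal (\<Psi>s z (covec_of A z c \<alpha>)))))"

definition dissipation_potentials ::
    "('z, 'e::real_normed_vector) chart set \<Rightarrow> ('z \<Rightarrow> ('z, 'e) tvec \<Rightarrow> ereal) \<Rightarrow>
     ('z \<Rightarrow> ('z, 'e) covec \<Rightarrow> ereal) \<Rightarrow> bool" where
  "dissipation_potentials A \<Psi> \<Psi>s \<longleftrightarrow> legendre_duals A \<Psi> \<Psi>s \<and>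
     strictly_convex_T A \<Psi> \<and> strictly_convex_Ts A \<Psi>s \<and> C1_T A \<Psi> \<and> C1_Ts A \<Psi>s \<and>
     (\<forall>z. \<Psi> z 0 = 0 \<and> \<Psi>s z 0 = 0)"

definition symmetric_T ::
    "('z, 'e::real_normed_vector) chart set \<Rightarrow> ('z \<Rightarrow> ('z, 'e) tvec \<Rightarrow> ereal) \<Rightarrow> bool" where
  "symmetric_T A \<Psi> \<longleftrightarrow> (\<forall>z. \<forall>v\<in>tangent_space A z. \<Psi> z v = \<Psi> z (- v))"

definition symmetric_Ts ::
    "('z, 'e::real_normed_vector) chart set \<Rightarrow> ('z \<Rightarrow> ('z, 'e) covec \<Rightarrow> ereal) \<Rightarrow> bool" where
  "symmetric_Ts A \<Psi>s \<longleftrightarrow> (\<forall>z. \<forall>\<xi>\<in>cotangent_space A z. \<Psi>s z \<xi> = \<Psi>s z (- \<xi>))"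


section \<open>Reversibility, zero-cost flows and pre-GENERIC\<close>

definition reversible ::
    "('z, 'e::real_normed_vector) chart set \<Rightarrow> ('z \<Rightarrow> real) \<Rightarrow> ('z \<Rightarrow> ('z, 'e) covec \<Rightarrow> real) \<Rightarrow> bool" where
  "reversible A S H \<longleftrightarrow> (\<forall>z. \<forall>\<xi>\<in>cotangent_space A z. H z \<xi> = H z (differential A S z - \<xi>))"

definition zero_cost_flow ::
    "('z, 'e::real_normed_vector) chart set \<Rightarrow> ('z \<Rightarrow> ('z, 'e) tvec) \<Rightarrow>
     ('z \<Rightarrow> ('z, 'e) tvec \<Rightarrow> ereal) \<Rightarrow> bool" where
  "zero_cost_flow A F L \<longleftrightarrow> (\<forall>z. \<forall>v\<in>tangent_space A z. L z v = 0 \<longleftrightarrow> v = F z)"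

definition orthogonal_to_differential ::
    "('z, 'e::real_normed_vector) chart set \<Rightarrow> ('z \<Rightarrow> ('z, 'e) tvec) \<Rightarrow> ('z \<Rightarrow> real) \<Rightarrow> bool" where
  "orthogonal_to_differential A W S \<longleftrightarrow> (\<forall>z. differential A S z (W z) = 0)"

definition pre_GENERIC ::
    "('z::topological_space, 'e::real_normed_vector) chart set \<Rightarrow> ('z \<Rightarrow> real) \<Rightarrow>
     ('z \<Rightarrow> ('z, 'e) tvec \<Rightarrow> ereal) \<Rightarrow> ('z \<Rightarrow> ('z, 'e) covec \<Rightarrow> ereal) \<Rightarrow>
     ('z \<Rightarrow> ('z, 'e) tvec) \<Rightarrow> ('z \<Rightarrow> ('z, 'e) tvec) \<Rightarrow> bool" where
  "pre_GENERIC A S \<Psi> \<Psi>s W F \<longleftrightarrow>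
     dissipation_potentials A \<Psi> \<Psi>s \<and> vector_field A W \<and>
     symmetric_T A \<Psi> \<and> symmetric_Ts A \<Psi>s \<and> orthogonal_to_differential A W S \<and>
     (\<forall>z. \<Psi> z (F z - W z) + \<Psi>s z (- ((1/2) *\<^sub>R differential A S z))
          + ereal (1/2 * differential A S z (F z)) = 0)"

definition lyapunov_function ::
    "('z, 'e::real_normed_vector) chart set \<Rightarrow> ('z \<Rightarrow> real) \<Rightarrow> ('z \<Rightarrow> ('z, 'e) tvec) \<Rightarrow> bool" where
  "lyapunov_function A S F \<longleftrightarrow> (\<forall>z. differential A S z (F z) \<le> 0)"

end

theory Submission
  imports Defs
begin

text \<open>
  Put \<open>\<theta> = dS(z)/2\<close>. Shifting the covariable by \<open>\<theta>\<close> in the supremum that defines \<open>L\<close>, and using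
  that \<open>W\<close> is orthogonal to \<open>dS\<close>, gives
  \<open>L(z,v) = \<Psi>(z, v - W(z)) + \<Psi>\<^sup>*(z, -\<theta>) + \<theta>(v)\<close>. So the pre-GENERIC equation is \<open>L(z, F(z)) = 0\<close>,
  and reversibility of \<open>H\<^sub>2\<close> is the evenness of \<open>\<Psi>\<^sup>*\<close>, read about \<open>\<theta>\<close>. Since \<open>L \<ge> 0\<close>, strict
  convexity of \<open>\<Psi>\<close> excludes a second zero of \<open>L(z, \<cdot>)\<close>.
\<close>

section \<open>Linearity of covectors on a tangent space\<close>

lemma subspace_cotangent_space: "subspace (cotangent_space A z)"
  by (rule subspaceI) (auto simp: cotangent_space_def algebra_simps)

lemma cotangent_space_add:
  assumes "\<xi> \<in> cotangent_space A z" "v \<in> tangent_space A z" "w \<in> tangent_space A z"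
  shows "\<xi> (v + w) = \<xi> v + \<xi> w"
  using assms unfolding cotangent_space_def by blast

lemma cotangent_space_scaleR:
  assumes "\<xi> \<in> cotangent_space A z" "v \<in> tangent_space A z"
  shows "\<xi> (r *\<^sub>R v) = r * \<xi> v"
  using assms unfolding cotangent_space_def by blast

lemma cotangent_space_diff:
  assumes M: "smooth_manifold A" and \<xi>: "\<xi> \<in> cotangent_space A z"
    and v: "v \<in> tangent_space A z" and w: "w \<in> tangent_space A z"
  shows "\<xi> (v - w) = \<xi> v - \<xi> w"
  using cotangent_space_add[OF \<xi> subspace_diff[OF subspace_tangent_space[OF M] v w] w] by simp

lemma cotangent_space_minus:
  assumes M: "smooth_manifold A" and \<xi>: "\<xi> \<in> cotangent_space A z" and v: "v \<in> tangent_space A z"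
  shows "\<xi> (- v) = - \<xi> v"
  using cotangent_space_scaleR[OF \<xi> v, of "-1"] by simp

section \<open>Reindexing suprema over a subspace\<close>

lemma SUP_subspace_translate:
  fixes f :: "'a::real_vector \<Rightarrow> 'b::complete_lattice"
  assumes V: "subspace V" and a: "a \<in> V"
  shows "(SUP x\<in>V. f x) = (SUP x\<in>V. f (x + a))"
proof -
  have "x \<in> (\<lambda>x. x + a) ` V" if "x \<in> V" for x
    by (rule image_eqI[where x = "x - a"]) (use subspace_diff[OF V that a] in auto)
  hence "(\<lambda>x. x + a) ` V = V"
    using subspace_add[OF V _ a] by auto
  thus ?thesis
    by (metis image_image)
qed

lemma SUP_subspace_minus:
  fixes f :: "'a::real_vector \<Rightarrow> 'b::complete_lattice"
  assumes V: "subspace V"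
  shows "(SUP x\<in>V. f x) = (SUP x\<in>V. f (- x))"
proof -
  have "x \<in> uminus ` V" if "x \<in> V" for x
    by (rule image_eqI[where x = "- x"]) (use subspace_neg[OF V that] in auto)
  hence "uminus ` V = V"
    using subspace_neg[OF V] by auto
  thus ?thesis
    by (metis image_image)
qed

section \<open>Legendre duality and strict convexity\<close>

lemma symmetric_T_if_symmetric_Ts:
  assumes M: "smooth_manifold A" and D: "legendre_duals A \<Psi> \<Psi>s" and sym: "symmetric_Ts A \<Psi>s"
  shows "symmetric_T A \<Psi>"
  unfolding symmetric_T_def
proof (intro allI ballI)
  fix z v assume v: "v \<in> tangent_space A z"
  have dual: "\<Psi> z u = (SUP \<xi>\<in>cotangent_space A z. ereal (\<xi> u) - \<Psi>s z \<xi>)"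
    if "u \<in> tangent_space A z" for u
    using D that unfolding legendre_duals_def by blast
  \<comment> \<open>Negating the index covector moves the sign onto \<open>v\<close> in the pairing,
    while evenness of \<Psi>s absorbs it in the other term.\<close>
  have "\<Psi> z v = (SUP \<xi>\<in>cotangent_space A z. ereal ((- \<xi>) v) - \<Psi>s z (- \<xi>))"
    unfolding dual[OF v] by (rule SUP_subspace_minus[OF subspace_cotangent_space])
  also have "\<dots> = (SUP \<xi>\<in>cotangent_space A z. ereal (\<xi> (- v)) - \<Psi>s z \<xi>)"
  proof (rule SUP_cong[OF refl])
    fix \<xi> assume \<xi>: "\<xi> \<in> cotangent_space A z"
    have "\<Psi>s z (- \<xi>) = \<Psi>s z \<xi>"
      using sym \<xi> unfolding symmetric_Ts_def by metis
    thus "ereal ((- \<xi>) v) - \<Psi>s z (- \<xi>) = ereal (\<xi> (- v)) - \<Psi>s z \<xi>"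
      using cotangent_space_minus[OF M \<xi> v] by simp
  qed
  also have "\<dots> = \<Psi> z (- v)"
    using dual[OF subspace_neg[OF subspace_tangent_space[OF M] v]] by simp
  finally show "\<Psi> z v = \<Psi> z (- v)" .
qed

text \<open>This supplies the normalisation of \<Psi> required by
  \<open>dissipation_potentials\<close>. At the zero vector every pairing vanishes, so the terms of
  the supremum are the values of -\<Psi>s, which are at most 0; the other inequality is
  nonnegativity of \<Psi>.\<close>

lemma legendre_duals_zero_T:
  assumes M: "smooth_manifold A" and D: "legendre_duals A \<Psi> \<Psi>s" and 0: "\<Psi>s z 0 = 0"
  shows "\<Psi> z 0 = 0"
proof -
  have T0: "0 \<in> tangent_space A z"
    by (rule subspace_0[OF subspace_tangent_space[OF M]])
  have eq: "\<Psi> z 0 = (SUP \<xi>\<in>cotangent_space A z. ereal (\<xi> 0) - \<Psi>s z \<xi>)"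
    using D T0 unfolding legendre_duals_def by blast
  have "\<Psi> z 0 \<le> 0"
    unfolding eq
  proof (rule SUP_least)
    fix \<xi> assume \<xi>: "\<xi> \<in> cotangent_space A z"
    have "0 \<le> \<Psi>s z \<xi>"
      using D \<xi> unfolding legendre_duals_def by blast
    moreover have "\<xi> 0 = 0"
      using cotangent_space_scaleR[OF \<xi> T0, of 0] by simp
    ultimately show "ereal (\<xi> 0) - \<Psi>s z \<xi> \<le> 0"
      by (cases "\<Psi>s z \<xi>") auto
  qed
  moreover have "0 \<le> \<Psi> z 0"
    using D T0 unfolding legendre_duals_def by blast
  ultimately show ?thesis by simp
qed

text \<open>After replacing \<xi> by \<xi> + \<theta>, each term splits into
  \<open>\<xi> (v - w) - \<Psi>s z \<xi>\<close>, with supremum \<open>\<Psi> z (v - w)\<close>, and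
  the summand \<open>\<theta> (v - w) + k\<close>, which does not depend on \<xi>. Finiteness of
  \<Psi>s lets this be computed in the reals.\<close>

lemma legendre_dual_shift:
  assumes M: "smooth_manifold A" and D: "legendre_duals A \<Psi> \<Psi>s"
    and fin: "\<And>\<xi>. \<xi> \<in> cotangent_space A z \<Longrightarrow> \<bar>\<Psi>s z \<xi>\<bar> \<noteq> \<infinity>"
    and \<theta>: "\<theta> \<in> cotangent_space A z"
    and v: "v \<in> tangent_space A z" and w: "w \<in> tangent_space A z"
    and H: "\<And>\<xi>. \<xi> \<in> cotangent_space A z \<Longrightarrow>
      ereal (H z \<xi>) = ereal (\<xi> w) + (\<Psi>s z (\<xi> - \<theta>) - ereal k)"
  shows "legendre_dual A H z v = \<Psi> z (v - w) + ereal (\<theta> (v - w) + k)"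
proof -
  have C: "subspace (cotangent_space A z)"
    by (rule subspace_cotangent_space)
  have vw: "v - w \<in> tangent_space A z"
    by (rule subspace_diff[OF subspace_tangent_space[OF M] v w])
  have "legendre_dual A H z v =
      (SUP \<xi>\<in>cotangent_space A z. ereal ((\<xi> + \<theta>) v - H z (\<xi> + \<theta>)))"
    unfolding legendre_dual_def by (rule SUP_subspace_translate[OF C \<theta>])
  also have "\<dots> = (SUP \<xi>\<in>cotangent_space A z.
      (ereal (\<xi> (v - w)) - \<Psi>s z \<xi>) + ereal (\<theta> (v - w) + k))"
  proof (rule SUP_cong[OF refl])
    fix \<xi> assume \<xi>: "\<xi> \<in> cotangent_space A z"
    obtain p where p: "\<Psi>s z \<xi> = ereal p"
      using fin[OF \<xi>] by (cases "\<Psi>s z \<xi>") auto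
    have "H z (\<xi> + \<theta>) = \<xi> w + \<theta> w + p - k"
      using H[OF subspace_add[OF C \<xi> \<theta>]] p by simp
    thus "ereal ((\<xi> + \<theta>) v - H z (\<xi> + \<theta>)) =
        (ereal (\<xi> (v - w)) - \<Psi>s z \<xi>) + ereal (\<theta> (v - w) + k)"
      using cotangent_space_diff[OF M \<xi> v w] cotangent_space_diff[OF M \<theta> v w] p by simp
  qed
  also have "\<dots> = (SUP \<xi>\<in>cotangent_space A z. ereal (\<xi> (v - w)) - \<Psi>s z \<xi>)
      + ereal (\<theta> (v - w) + k)"
    \<comment> \<open>Pulling the constant out needs a nonempty index set; \<theta> is an element of
      it.\<close>
    by (rule SUP_ereal_add_left) (use \<theta> in auto)
  also have "(SUP \<xi>\<in>cotangent_space A z. ereal (\<xi> (v - w)) - \<Psi>s z \<xi>) = \<Psi> z (v - w)"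
    by (rule sym) (use D vw in \<open>unfold legendre_duals_def, blast\<close>)
  finally show ?thesis .
qed

text \<open>Two distinct zeros of the nonnegative function f + g would make it negative at their
  midpoint, where f lies strictly below its average and g equals its average. In the application g
  is a covector plus a constant.\<close>

lemma strictly_convex_on_zero_unique:
  assumes V: "subspace V" and sc: "strictly_convex_on V f"
    and mid: "g ((1/2) *\<^sub>R a + (1/2) *\<^sub>R b) = (g a + g b) / 2"
    and ge: "\<And>x. x \<in> V \<Longrightarrow> 0 \<le> f x + ereal (g x)"
    and a: "a \<in> V" "f a + ereal (g a) = 0" and b: "b \<in> V" "f b + ereal (g b) = 0"
  shows "a = b"
proof (rule ccontr)
  assume ne: "a \<noteq> b"
  \<comment> \<open>A zero forces a finite value of \<open>f\<close>, so both points lie in the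
    effective domain, where strict convexity applies.\<close>
  have fa: "f a = ereal (- g a)"
    using a(2) by (cases "f a") auto
  have fb: "f b = ereal (- g b)"
    using b(2) by (cases "f b") auto
  let ?m = "(1/2) *\<^sub>R a + (1/2) *\<^sub>R b"
  have "f ((1 - 1/2) *\<^sub>R a + (1/2) *\<^sub>R b) < ereal (1 - 1/2) * f a + ereal (1/2) * f b"
    by (rule sc[unfolded strictly_convex_on_def, rule_format, OF a(1) b(1)])
      (use ne fa fb in auto)
  hence "f ?m < ereal (- (g a + g b) / 2)"
    by (simp add: fa fb field_simps)
  moreover have "?m \<in> V"
    using V a(1) b(1) by (intro subspace_add subspace_scale)
  hence "0 \<le> f ?m + ereal ((g a + g b) / 2)"
    using ge mid by metis
  ultimately show False
    by (cases "f ?m") (auto simp: field_simps)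
qed

theorem theorem3p6:
  fixes A :: "('z::{t2_space, second_countable_topology}, 'e::real_normed_vector) chart set"
    and S :: "'z \<Rightarrow> real"
    and F W :: "'z \<Rightarrow> ('z, 'e) tvec"
    and \<Psi> :: "'z \<Rightarrow> ('z, 'e) tvec \<Rightarrow> ereal"
    and \<Psi>s :: "'z \<Rightarrow> ('z, 'e) covec \<Rightarrow> ereal"
    and H\<^sub>1 H\<^sub>2 H :: "'z \<Rightarrow> ('z, 'e) covec \<Rightarrow> real"
    and L :: "'z \<Rightarrow> ('z, 'e) tvec \<Rightarrow> ereal"
  assumes "smooth_manifold A"
    and "C1_function A S"
    and "vector_field A F"
    and "legendre_duals A \<Psi> \<Psi>s"
    and "strictly_convex_T A \<Psi>" and "strictly_convex_Ts A \<Psi>s"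
    and "C1_T A \<Psi>" and "C1_Ts A \<Psi>s"
    and "vector_field A W"
    and "orthogonal_to_differential A W S"
    and "H\<^sub>1 = (\<lambda>z \<xi>. \<xi> (W z))"
    and "\<And>z \<xi>. \<xi> \<in> cotangent_space A z \<Longrightarrow>
      \<Psi>s z \<xi> = ereal (H\<^sub>2 z (\<xi> + (1/2) *\<^sub>R differential A S z)
                      - H\<^sub>2 z ((1/2) *\<^sub>R differential A S z))"
    and "\<And>z \<xi>. \<xi> \<in> cotangent_space A z \<Longrightarrow>
      ereal (H\<^sub>2 z \<xi>) = \<Psi>s z (\<xi> - (1/2) *\<^sub>R differential A S z)
                      - \<Psi>s z (- ((1/2) *\<^sub>R differential A S z))"
    and "H = (\<lambda>z \<xi>. H\<^sub>1 z \<xi> + H\<^sub>2 z \<xi>)"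
    and "L = legendre_dual A H"
  shows "((reversible A S H\<^sub>2 \<and> zero_cost_flow A F L) \<longleftrightarrow>
            (symmetric_Ts A \<Psi>s \<and> pre_GENERIC A S \<Psi> \<Psi>s W F)) \<and>
         ((reversible A S H\<^sub>2 \<and> zero_cost_flow A F L) \<or>
            (symmetric_Ts A \<Psi>s \<and> pre_GENERIC A S \<Psi> \<Psi>s W F)
            \<longrightarrow> lyapunov_function A S F)"
proof -
  note M = assms(1) and D = assms(4)
  define \<theta> where "\<theta> z = (1/2) *\<^sub>R differential A S z" for z
  define k where "k z = real_of_ereal (\<Psi>s z (- \<theta> z))" for z
  have T: "subspace (tangent_space A z)" and C: "subspace (cotangent_space A z)" for z
    using subspace_tangent_space[OF M] subspace_cotangent_space by auto
  have dS: "differential A S z \<in> cotangent_space A z" for z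
    by (rule differential_in_cotangent_space[OF M assms(2)])
  have \<theta>: "\<theta> z \<in> cotangent_space A z" for z
    unfolding \<theta>_def by (rule subspace_scale[OF C dS])
  have Ft: "F z \<in> tangent_space A z" and Wt: "W z \<in> tangent_space A z" for z
    using assms(3,9) unfolding vector_field_def by auto
  have fin: "\<bar>\<Psi>s z \<xi>\<bar> \<noteq> \<infinity>" if "\<xi> \<in> cotangent_space A z" for z \<xi>
    using assms(8) that unfolding C1_Ts_def by simp
  have k: "\<Psi>s z (- \<theta> z) = ereal (k z)" for z
    unfolding k_def using fin[OF subspace_neg[OF C \<theta>]] by (simp add: ereal_real)
  have H2: "ereal (H\<^sub>2 z \<xi>) = \<Psi>s z (\<xi> - \<theta> z) - ereal (k z)" if "\<xi> \<in> cotangent_space A z" for z \<xi>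
    using assms(13)[OF that] k unfolding \<theta>_def by simp
  \<comment> \<open>At the zero covector the first relation between \<Psi>s and
    \<open>H\<^sub>2\<close> subtracts \<open>H\<^sub>2 z (\<theta> z)\<close> from itself.\<close>
  have \<Psi>s0: "\<Psi>s z 0 = 0" for z
    using assms(12)[OF subspace_0[OF C]] by simp
  have L: "L z v = \<Psi> z (v - W z) + ereal (\<theta> z (v - W z) + k z)"
    if v: "v \<in> tangent_space A z" for z v
    unfolding assms(15)
  proof (rule legendre_dual_shift[OF M D fin \<theta> v Wt])
    show "ereal (H z \<xi>) = ereal (\<xi> (W z)) + (\<Psi>s z (\<xi> - \<theta> z) - ereal (k z))"
      if "\<xi> \<in> cotangent_space A z" for \<xi>
      using H2[OF that] by (simp add: assms(11,14) flip: plus_ereal.simps(1))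
  qed
  \<comment> \<open>The zero covector competes in the supremum with value 0, because
    \<open>H z 0\<close> reduces to \<open>k z - k z\<close>.\<close>
  have L_ge: "0 \<le> L z v" if v: "v \<in> tangent_space A z" for z v
  proof -
    have "H z 0 = 0"
      using H2[OF subspace_0[OF C], of z] k[of z] by (simp add: assms(11,14))
    moreover have "ereal (0 v - H z 0) \<le> L z v"
      unfolding assms(15) legendre_dual_def by (rule SUP_upper[OF subspace_0[OF C]])
    ultimately show ?thesis by (simp add: zero_ereal_def)
  qed
  have \<theta>W: "\<theta> z (v - W z) = 1/2 * differential A S z v" if "v \<in> tangent_space A z" for z v
    using cotangent_space_diff[OF M \<theta> that Wt] assms(10)
    by (simp add: \<theta>_def orthogonal_to_differential_def)
  have LF: "L z (F z) = \<Psi> z (F z - W z) + \<Psi>s z (- \<theta> z)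
      + ereal (1/2 * differential A S z (F z))" for z
    unfolding L[OF Ft] \<theta>W[OF Ft] k
    by (cases "\<Psi> z (F z - W z)") (auto simp: algebra_simps)
  have unique: "v = F z"
    if v: "v \<in> tangent_space A z" and "L z v = 0" "L z (F z) = 0" for z v
  proof -
    let ?g = "\<lambda>a. \<theta> z a + k z"
    have "v - W z = F z - W z"
    proof (rule strictly_convex_on_zero_unique[OF T, where f = "\<Psi> z" and g = ?g])
      show "strictly_convex_on (tangent_space A z) (\<Psi> z)"
        using assms(5) unfolding strictly_convex_T_def by blast
      show vW: "v - W z \<in> tangent_space A z" and FW: "F z - W z \<in> tangent_space A z"
        using v Ft Wt subspace_diff[OF T] by auto
      show "?g ((1/2) *\<^sub>R (v - W z) + (1/2) *\<^sub>R (F z - W z)) =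
          (?g (v - W z) + ?g (F z - W z)) / 2"
        unfolding cotangent_space_add[OF \<theta> subspace_scale[OF T vW] subspace_scale[OF T FW]]
          cotangent_space_scaleR[OF \<theta> vW] cotangent_space_scaleR[OF \<theta> FW]
        by (simp add: field_simps)
      \<comment> \<open>By the formula for \<open>L\<close>, this sum is
        \<open>L z (x + W z)\<close>.\<close>
      show "0 \<le> \<Psi> z x + ereal (?g x)" if "x \<in> tangent_space A z" for x
        using L_ge[OF subspace_add[OF T that Wt]] L[OF subspace_add[OF T that Wt]] by simp
      show "\<Psi> z (v - W z) + ereal (?g (v - W z)) = 0"
        "\<Psi> z (F z - W z) + ereal (?g (F z - W z)) = 0"
        using L[OF v] L[OF Ft] that by auto
    qed
    thus ?thesis by simp
  qed
  \<comment> \<open>Uniqueness of the zero is automatic, so being the zero-cost flow only requires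
    \<open>F z\<close> to be a zero.\<close>
  have zero_cost: "zero_cost_flow A F L \<longleftrightarrow> (\<forall>z. L z (F z) = 0)"
    unfolding zero_cost_flow_def using unique Ft by blast
  \<comment> \<open>For fixed \<open>z\<close>, \<open>H\<^sub>2\<close> is a translate of \<Psi>s
    minus the constant \<open>k z\<close>, which cancels.\<close>
  have H2_eq: "H\<^sub>2 z \<xi> = H\<^sub>2 z \<eta> \<longleftrightarrow> \<Psi>s z (\<xi> - \<theta> z) = \<Psi>s z (\<eta> - \<theta> z)"
    if \<xi>: "\<xi> \<in> cotangent_space A z" and \<eta>: "\<eta> \<in> cotangent_space A z" for z \<xi> \<eta>
    using H2[OF \<xi>] H2[OF \<eta>] by (cases "\<Psi>s z (\<xi> - \<theta> z)"; cases "\<Psi>s z (\<eta> - \<theta> z)") auto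
  \<comment> \<open>The reflection in the definition of \<open>reversible\<close> has centre
    \<open>\<theta> z\<close>, so in coordinates centred there it is negation.\<close>
  have dS\<theta>: "differential A S z - \<xi> - \<theta> z = - (\<xi> - \<theta> z)" for z \<xi>
    by (simp add: \<theta>_def fun_eq_iff)
  have rev: "reversible A S H\<^sub>2 \<longleftrightarrow> symmetric_Ts A \<Psi>s"
  proof
    assume R: "reversible A S H\<^sub>2"
    show "symmetric_Ts A \<Psi>s"
      unfolding symmetric_Ts_def
    proof (intro allI ballI)
      fix z \<xi> assume "\<xi> \<in> cotangent_space A z"
      hence \<eta>: "\<xi> + \<theta> z \<in> cotangent_space A z"
        using subspace_add[OF C _ \<theta>] by blast
      hence "H\<^sub>2 z (\<xi> + \<theta> z) = H\<^sub>2 z (differential A S z - (\<xi> + \<theta> z))"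
        using R unfolding reversible_def by blast
      thus "\<Psi>s z \<xi> = \<Psi>s z (- \<xi>)"
        unfolding H2_eq[OF \<eta> subspace_diff[OF C dS \<eta>]] dS\<theta> by simp
    qed
  next
    assume s: "symmetric_Ts A \<Psi>s"
    show "reversible A S H\<^sub>2"
      unfolding reversible_def
    proof (intro allI ballI)
      fix z \<xi> assume \<xi>: "\<xi> \<in> cotangent_space A z"
      show "H\<^sub>2 z \<xi> = H\<^sub>2 z (differential A S z - \<xi>)"
        unfolding H2_eq[OF \<xi> subspace_diff[OF C dS \<xi>]] dS\<theta>
        using s subspace_diff[OF C \<xi> \<theta>] unfolding symmetric_Ts_def by blast
    qed
  qed
  have "dissipation_potentials A \<Psi> \<Psi>s"
    using assms(4-8) \<Psi>s0 legendre_duals_zero_T[OF M D \<Psi>s0]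
    unfolding dissipation_potentials_def by blast
  \<comment> \<open>Symmetry of \<Psi>s stays on both sides because symmetry of \<Psi> is derived
    from it.\<close>
  hence pre: "symmetric_Ts A \<Psi>s \<and> pre_GENERIC A S \<Psi> \<Psi>s W F \<longleftrightarrow>
      symmetric_Ts A \<Psi>s \<and> (\<forall>z. L z (F z) = 0)"
    using assms(9,10) symmetric_T_if_symmetric_Ts[OF M D]
    unfolding pre_GENERIC_def LF \<theta>_def by blast
  \<comment> \<open>In the formula for \<open>L z (F z)\<close> both potentials are nonnegative, so
    a zero total forces the pairing term to be at most 0.\<close>
  have lyapunov: "lyapunov_function A S F" if "\<forall>z. L z (F z) = 0"
    unfolding lyapunov_function_def
  proof
    fix z
    have "F z - W z \<in> tangent_space A z" "- \<theta> z \<in> cotangent_space A z"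
      by (rule subspace_diff[OF T Ft Wt], rule subspace_neg[OF C \<theta>])
    hence "0 \<le> \<Psi> z (F z - W z)" "0 \<le> \<Psi>s z (- \<theta> z)"
      using conjunct1[OF D[unfolded legendre_duals_def]]
        conjunct1[OF conjunct2[OF D[unfolded legendre_duals_def]]] by blast+
    moreover have "\<Psi> z (F z - W z) + \<Psi>s z (- \<theta> z) + ereal (1/2 * differential A S z (F z)) = 0"
      using that LF by metis
    ultimately show "differential A S z (F z) \<le> 0"
      unfolding k by (cases "\<Psi> z (F z - W z)") auto
  qed
  show ?thesis
    unfolding zero_cost rev pre using lyapunov by blast
qed

end
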